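(* The unary operation $x\mapsto 2^x$ on $\mathbb{N}$ does not belong to $\langle x+y,\ x\bmod y\rangle$.
   Context: $\mathbb{N}$ is the set of non-negative integers. An ($r$-ary, $r\ge 1$) operation on $\mathbb{N}$ is a function $\mathbb{N}^r\to\mathbb{N}$. Conventions: $\lfloor x/0\rfloor:=0$, and $x\bmod y:=\max(x-y\lfloor x/y\rfloor,0)$, so that $x\bmod 0=x$. A set $S$ of operations on $\mathbb{N}$ is closed under substitution if, whenever $f\in S$ is $r$-ary and $g_1,\dots,g_r\in S$ are $n$-ary, the operation $\vec x\mapsto f(g_1(\vec x),\dots,g_r(\vec x))$ is in $S$. For a set $\mathcal{B}$ of operations on $\mathbb{N}$, $\langle\mathcal{B}\rangle$ denotes the closure under substitution of $\mathcal{B}\cup C\cup P$, where $C$ is the set of all constant operations on $\mathbb{N}$ (of every arity) and $P$ is the set of all projections $(x_1,\dots,x_n)\mapsto x_i$. Here $x+y$ and $x\bmod y$ denote the corresponding binary operations. *)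

theory Defs
  imports Complex_Main "HOL-Library.FuncSet"
begin

text \<open>
  An r-ary operation on the natural numbers is a pair of its arity r and a function on the lists
  of length r. The arity is part of the operation, and the function is cut off to lists of length
  r, so that two operations are equal iff they have the same arity and agree on all argument
  tuples of that arity. All arities are at least 1.
\<close>

type_synonym operation = "nat \<times> (nat list \<Rightarrow> nat)"

definition operation :: "nat \<Rightarrow> (nat list \<Rightarrow> nat) \<Rightarrow> operation" where
  "operation r f = (r, restrict f {xs. length xs = r})"

lemma operation_eq_iff:
  "operation r f = operation s g \<longleftrightarrow> r = s \<and> (\<forall>xs. length xs = r \<longrightarrow> f xs = g xs)"
  by (auto simp: operation_def restrict_def fun_eq_iff)

definition unary :: "(nat \<Rightarrow> nat) \<Rightarrow> operation" where
  "unary h = operation 1 (\<lambda>xs. h (xs ! 0))"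

definition binary :: "(nat \<Rightarrow> nat \<Rightarrow> nat) \<Rightarrow> operation" where
  "binary h = operation 2 (\<lambda>xs. h (xs ! 0) (xs ! 1))"

definition constants :: "operation set" where
  "constants = {operation n (\<lambda>xs. c) | n c. n \<ge> 1}"

definition projections :: "operation set" where
  "projections = {operation n (\<lambda>xs. xs ! i) | n i. i < n}"

definition closed_under_substitution :: "operation set \<Rightarrow> bool" where
  "closed_under_substitution S \<longleftrightarrow>
     (\<forall>r n f gs. r \<ge> 1 \<and> n \<ge> 1 \<and> operation r f \<in> S \<and>
        length gs = r \<and> (\<forall>g \<in> set gs. operation n g \<in> S) \<longrightarrow>
        operation n (\<lambda>xs. f (map (\<lambda>g. g xs) gs)) \<in> S)"

definition generated :: "operation set \<Rightarrow> operation set" where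
  "generated B = closed_under_substitution hull (B \<union> constants \<union> projections)"

text \<open>
  The intersection of all closed supersets is itself closed, so it is the least one.
\<close>

lemma closed_under_substitution_generated: "closed_under_substitution (generated B)"
proof -
  have "closed_under_substitution (\<Inter>T)"
    if T: "\<And>S. S \<in> T \<Longrightarrow> closed_under_substitution S" for T
    unfolding closed_under_substitution_def
  proof (intro allI impI InterI)
    fix r n f gs S
    assume h: "r \<ge> 1 \<and> n \<ge> 1 \<and> operation r f \<in> \<Inter>T \<and>
        length gs = r \<and> (\<forall>g \<in> set gs. operation n g \<in> \<Inter>T)" and S: "S \<in> T"
    show "operation n (\<lambda>xs. f (map (\<lambda>g. g xs) gs)) \<in> S"
      by (rule T[OF S, unfolded closed_under_substitution_def, rule_format, of r])
         (use h S in auto)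
  qed
  then show ?thesis
    unfolding generated_def by (rule hull_in[where S = closed_under_substitution]) simp
qed

text \<open>
  The library's \<^term>\<open>(mod)\<close> on \<^typ>\<open>nat\<close> is the intended operation, also for modulus 0.
  (Division of reals by 0 gives 0.)
\<close>

lemma nat_mod_eq_max:
  "int (x mod y) = max (int x - int y * \<lfloor>real x / real y\<rfloor>) 0"
proof -
  have "int x - int y * int (x div y) = int (x mod y)"
    by (metis minus_mult_div_eq_mod of_nat_mod zdiv_int)
  then show ?thesis
    by (simp only: floor_divide_of_nat_eq max_absorb1 of_nat_0_le_iff)
qed

end

theory Submission
  imports Defs
begin

text \<open>
  Every operation in the closure grows at most linearly in the sum of its arguments: this holds
  for sums, for constants and for projections, also for remainders because
  \<open>x mod y \<le> x\<close>, and it is preserved by substitution. But \<open>2 ^ x\<close> grows faster.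
\<close>

text \<open>The summand \<open>1\<close> leaves room for nonzero constants at the all-zero argument
  list, so that a single factor \<open>c\<close> can replace an affine bound.\<close>

definition linearly_bounded :: "nat \<Rightarrow> (nat list \<Rightarrow> nat) \<Rightarrow> bool" where
  "linearly_bounded n f \<longleftrightarrow> (\<exists>c. \<forall>xs. length xs = n \<longrightarrow> f xs \<le> c * (1 + sum_list xs))"

definition linearly_bounded_operations :: "operation set" where
  "linearly_bounded_operations = {operation n f | n f. linearly_bounded n f}"

text \<open>Independence of the representative: functions giving the same operation agree on lists
  of length \<open>n\<close>, and the bound looks at no other lists.\<close>

lemma operation_in_linearly_bounded_operations_iff:
  "operation n f \<in> linearly_bounded_operations \<longleftrightarrow> linearly_bounded n f"
  unfolding linearly_bounded_operations_def linearly_bounded_def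
  by (simp add: operation_eq_iff del: mult_Suc_right) metis

lemma linearly_boundedI:
  "(\<And>xs. length xs = n \<Longrightarrow> f xs \<le> c * (1 + sum_list xs)) \<Longrightarrow> linearly_bounded n f"
  by (auto simp: linearly_bounded_def)

text \<open>The factors of the summands add up. This controls the sum of the inner values in a
  substitution.\<close>

lemma linearly_bounded_sum_list:
  assumes "\<And>g. g \<in> set gs \<Longrightarrow> linearly_bounded n g"
  shows "linearly_bounded n (\<lambda>xs. \<Sum>g\<leftarrow>gs. g xs)"
  using assms
proof (induction gs)
  case Nil
  show ?case by (simp add: linearly_bounded_def)
next
  case (Cons g gs)
  then obtain c d where
      c: "\<And>xs. length xs = n \<Longrightarrow> g xs \<le> c * (1 + sum_list xs)" and
      d: "\<And>xs. length xs = n \<Longrightarrow> (\<Sum>g\<leftarrow>gs. g xs) \<le> d * (1 + sum_list xs)"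
    unfolding linearly_bounded_def by (meson list.set_intros)
  show ?case
  proof (rule linearly_boundedI[where c = "c + d"])
    fix xs :: "nat list"
    assume "length xs = n"
    then show "(\<Sum>g\<leftarrow>g # gs. g xs) \<le> (c + d) * (1 + sum_list xs)"
      using add_mono[OF c d, of xs xs] by (simp add: distrib_right)
  qed
qed

text \<open>The bound on \<open>f\<close> depends only on the sum of its arguments, and that sum is
  itself linearly bounded in \<open>xs\<close>.\<close>

lemma linearly_bounded_substitution:
  assumes f: "linearly_bounded (length gs) f"
    and gs: "\<And>g. g \<in> set gs \<Longrightarrow> linearly_bounded n g"
  shows "linearly_bounded n (\<lambda>xs. f (map (\<lambda>g. g xs) gs))"
proof -
  from f obtain c where
    c: "\<And>ys. length ys = length gs \<Longrightarrow> f ys \<le> c * (1 + sum_list ys)"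
    unfolding linearly_bounded_def by blast
  from linearly_bounded_sum_list[OF gs] obtain d where
    d: "\<And>xs. length xs = n \<Longrightarrow> (\<Sum>g\<leftarrow>gs. g xs) \<le> d * (1 + sum_list xs)"
    unfolding linearly_bounded_def by blast
  show ?thesis
  proof (rule linearly_boundedI[where c = "c * (1 + d)"])
    fix xs :: "nat list"
    assume xs: "length xs = n"
    have "f (map (\<lambda>g. g xs) gs) \<le> c * (1 + (\<Sum>g\<leftarrow>gs. g xs))"
      by (rule c) simp
    \<comment> \<open>The leading \<open>1\<close> is absorbed using
      \<open>1 \<le> 1 + sum_list xs\<close>.\<close>
    also have "\<dots> \<le> c * ((1 + d) * (1 + sum_list xs))"
      using d[OF xs] by (intro mult_le_mono2) simp
    finally show "f (map (\<lambda>g. g xs) gs) \<le> c * (1 + d) * (1 + sum_list xs)"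
      by (simp only: mult.assoc)
  qed
qed

lemma closed_under_substitution_linearly_bounded_operations:
  "closed_under_substitution linearly_bounded_operations"
  unfolding closed_under_substitution_def operation_in_linearly_bounded_operations_iff
  using linearly_bounded_substitution by blast

text \<open>By minimality of the hull, only the generators need checking: a constant
  \<open>a\<close> has factor \<open>a\<close>, and a projection has factor \<open>1\<close> since
  an entry is at most the sum of its list.\<close>

lemma generated_subset_linearly_bounded_operations:
  assumes "B \<subseteq> linearly_bounded_operations"
  shows "generated B \<subseteq> linearly_bounded_operations"
proof -
  have "linearly_bounded n (\<lambda>xs. a)" for n a
    by (rule linearly_boundedI[where c = a]) simp
  then have "constants \<subseteq> linearly_bounded_operations"
    by (auto simp: constants_def operation_in_linearly_bounded_operations_iff)
  moreover have "linearly_bounded n (\<lambda>xs. xs ! i)" if "i < n" for n i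
    by (rule linearly_boundedI[where c = 1]) (use that in \<open>simp add: elem_le_sum_list le_SucI\<close>)
  then have "projections \<subseteq> linearly_bounded_operations"
    by (auto simp: projections_def operation_in_linearly_bounded_operations_iff)
  ultimately show ?thesis
    unfolding generated_def
    using assms closed_under_substitution_linearly_bounded_operations by (intro hull_minimal) auto
qed

text \<open>Covers both generators: the hypothesis is an equality for addition and follows from
  \<open>x mod y \<le> x\<close> for the remainder.\<close>

lemma binary_in_linearly_bounded_operations:
  assumes "\<And>x y. h x y \<le> x + y"
  shows "binary h \<in> linearly_bounded_operations"
  unfolding binary_def operation_in_linearly_bounded_operations_iff
proof (rule linearly_boundedI[where c = 1])
  fix xs :: "nat list"
  assume "length xs = 2"
  then obtain x y where "xs = [x, y]"
    by (auto simp: length_Suc_conv numeral_2_eq_2)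
  then show "h (xs ! 0) (xs ! 1) \<le> 1 * (1 + sum_list xs)"
    using assms[of x y] by simp
qed

lemma power2_not_linearly_bounded: "\<exists>x. c * (1 + x) < 2 ^ x" for c :: nat
proof
  \<comment> \<open>The witness is \<open>x = 4 * c\<close>. Halving the exponent and applying
    \<open>n < 2 ^ n\<close> at \<open>n = 2 * c\<close> to each half gives a square that exceeds
    the left side, also quadratic in \<open>c\<close>.\<close>
  have "c * (1 + 4 * c) < (2 * c + 1) * (2 * c + 1)"
    by (simp add: algebra_simps)
  also have "\<dots> \<le> 2 ^ (2 * c) * 2 ^ (2 * c)"
    by (intro mult_le_mono) (simp_all add: Suc_leI)
  also have "\<dots> = 2 ^ (4 * c)"
    by (simp flip: power_add)
  finally show "c * (1 + 4 * c) < 2 ^ (4 * c)" .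
qed

theorem theorem10:
  shows "unary (\<lambda>x. 2 ^ x) \<notin> generated {binary (\<lambda>x y. x + y), binary (\<lambda>x y. x mod y)}"
proof
  assume "unary (\<lambda>x. 2 ^ x) \<in> generated {binary (\<lambda>x y. x + y), binary (\<lambda>x y. x mod y)}"
  moreover have "{binary (\<lambda>x y. x + y), binary (\<lambda>x y. x mod y)} \<subseteq> linearly_bounded_operations"
    using binary_in_linearly_bounded_operations by (simp add: trans_le_add1)
  ultimately have "unary (\<lambda>x. 2 ^ x) \<in> linearly_bounded_operations"
    using generated_subset_linearly_bounded_operations by blast
  then obtain c where c: "\<And>xs. length xs = 1 \<Longrightarrow> 2 ^ (xs ! 0) \<le> c * (1 + sum_list xs)"
    unfolding unary_def operation_in_linearly_bounded_operations_iff linearly_bounded_def by blast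
  obtain x where "c * (1 + x) < 2 ^ x"
    using power2_not_linearly_bounded by blast
  with c[of "[x]"] show False by simp
qed

end
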